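(* Let $n\ge 1$ be an odd integer, let $p$ be an odd prime, and let $m=2p^{\alpha}$ where $\alpha$ is a positive integer. Suppose that an $(m,n)$-generalized bent function exists. Then $p<2^{n-3}$ unless $p=2^{n-2}-1$ is a Mersenne prime (that is, either $p<2^{n-3}$ or $p=2^{n-2}-1$). In particular, if $n$ is odd and $n\le 3$, then for every odd prime $p$ and every positive integer $\alpha$ there is no $(p^{\alpha},n)$-generalized bent function and no $(2p^{\alpha},n)$-generalized bent function.
   Context: For integers $m\ge 2$ and $n\ge 1$, put $\zeta_m=e^{2\pi\sqrt{-1}/m}$. A function $f:\mathbb{Z}_2^n\to\mathbb{Z}_m$ (where $\mathbb{Z}_m=\mathbb{Z}/m\mathbb{Z}$) is called an $(m,n)$-generalized bent function ($(m,n)$-GBF) if $|F(y)|^2=2^n$ for all $y\in\mathbb{Z}_2^n$, where $F(y)=\sum_{x\in\mathbb{Z}_2^n}\zeta_m^{f(x)}(-1)^{y\cdot x}$ and $y\cdot x$ is the usual inner product. A Mersenne prime is a prime of the form $2^k-1$. *)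

theory Defs
  imports Complex_Main "HOL-Library.FuncSet" "HOL-Number_Theory.Residues"
begin

text \<open>
  The group of integers modulo \<open>m\<close> is the carrier \<open>{0..m - 1}\<close> of the library's
  \<^const>\<open>residue_ring\<close>, and a vector of length \<open>n\<close> is an extensional function
  on the index set \<open>{..<n}\<close>, so that \<open>n\<close> can be a variable of the statement.
\<close>

definition Z2_vec :: "nat \<Rightarrow> (nat \<Rightarrow> int) set" where
  "Z2_vec n = {..<n} \<rightarrow>\<^sub>E carrier (residue_ring 2)"

definition Z2_inner :: "nat \<Rightarrow> (nat \<Rightarrow> int) \<Rightarrow> (nat \<Rightarrow> int) \<Rightarrow> int" where
  "Z2_inner n y x = (\<Sum>i<n. y i * x i) mod 2"

definition zeta :: "nat \<Rightarrow> complex" where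
  "zeta m = exp (2 * of_real pi * \<i> / of_nat m)"

definition gbf_transform ::
    "nat \<Rightarrow> nat \<Rightarrow> ((nat \<Rightarrow> int) \<Rightarrow> int) \<Rightarrow> (nat \<Rightarrow> int) \<Rightarrow> complex" where
  "gbf_transform m n f y =
     (\<Sum>x\<in>Z2_vec n. zeta m powi f x * (-1) powi Z2_inner n y x)"

text \<open>Values of \<open>f\<close> outside \<open>Z2_vec n\<close> are unconstrained and irrelevant.\<close>

definition is_gbf :: "nat \<Rightarrow> nat \<Rightarrow> ((nat \<Rightarrow> int) \<Rightarrow> int) \<Rightarrow> bool" where
  "is_gbf m n f \<longleftrightarrow>
     f \<in> Z2_vec n \<rightarrow> carrier (residue_ring (int m)) \<and>
     (\<forall>y\<in>Z2_vec n. (cmod (gbf_transform m n f y))\<^sup>2 = 2 ^ n)"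

definition mersenne_prime :: "nat \<Rightarrow> bool" where
  "mersenne_prime p \<longleftrightarrow> prime p \<and> (\<exists>k::nat. p = 2 ^ k - 1)"

end

theory Submission imports Defs begin

text \<open>
  By Fourier inversion, \<open>f\<close> is a generalized bent function only if, for every nonzero \<open>t\<close>, the sum
  of \<open>\<zeta> ^ (f z - f (z + t))\<close> over \<open>z\<close> vanishes. For \<open>m = 2 p\<^sup>\<alpha>\<close> the residue map modulo the prime
  above \<open>p\<close> sends \<open>\<zeta>\<close> to \<open>-1\<close>, so the autocorrelations \<open>r t\<close> of the sign function
  \<open>g = (-1) ^ f\<close> are divisible by \<open>p\<close> for \<open>t \<noteq> 0\<close>; they do not all vanish, because the sum of all
  \<open>r t\<close>, including \<open>r 0 = 2\<^sup>n\<close>, is a square and \<open>n\<close> is odd. Let \<open>S\<close> be the sum of \<open>g\<close>, so that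
  \<open>r t \<equiv> 2 S (mod 8)\<close>.

  If \<open>4\<close> divides \<open>S\<close>, some \<open>r t\<close> is a nonzero multiple of \<open>8 p\<close>, whence \<open>8 p \<le> 2\<^sup>n\<close>. Otherwise, if
  \<open>8 p > 2\<^sup>n\<close>, every \<open>r t\<close> with \<open>t \<noteq> 0\<close> is \<open>4 p\<close> or \<open>-4 p\<close>, which exceeds \<open>2\<^sup>n / 2\<close> in absolute value;
  then the sign of \<open>r\<close> is a character. The Fourier coefficients of \<open>g\<close> at this character and at any
  other one have squares \<open>2\<^sup>n + 4 p (2\<^sup>n - 1)\<close> and \<open>2\<^sup>n - 4 p\<close>, and factoring the difference
  of these squares leaves only \<open>p = 2\<^bsup>n - 2\<^esup> - 1\<close>.
\<close>

section \<open>Vanishing sums of roots of unity\<close>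

text \<open>A basis of the complex numbers over the rationals can be chosen to contain 1. Such a
  functional turns identities between complex numbers into rational ones and fixes the
  integers.\<close>

lemma rat_functional_exists:
  "\<exists>l :: complex \<Rightarrow> rat. l 1 = 1 \<and> (\<forall>x y. l (x + y) = l x + l y) \<and>
      (\<forall>q x. l (of_rat q * x) = q * l x)"
proof -
  interpret vector_space_pair "\<lambda>(q::rat) (z::complex). of_rat q * z" "\<lambda>(q::rat) (z::rat). q * z"
    by unfold_locales (auto simp: algebra_simps of_rat_add of_rat_mult)
  have "vs1.independent {1::complex}"
    by (simp add: vs1.dependent_single)
  from linear_independent_extend[OF this, of "\<lambda>_. 1"] obtain g
    where "Vector_Spaces.linear (\<lambda>(q::rat) (z::complex). of_rat q * z) (\<lambda>(q::rat) (z::rat). q * z) g" "g 1 = 1"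
    by auto
  then show ?thesis
    by (intro exI[of _ g]) (auto simp: linear_iff Vector_Spaces.linear_iff)
qed

lemma common_denominator:
  fixes f :: "nat \<Rightarrow> rat"
  shows "\<exists>D::int. D > 0 \<and> (\<forall>i<k. of_int D * f i \<in> \<int>)"
proof (induction k)
  case 0
  show ?case by (intro exI[of _ 1]) auto
next
  case (Suc k)
  then obtain D :: int where D: "D > 0" "\<forall>i<k. of_int D * f i \<in> \<int>" by blast
  obtain a b where ab: "f k = of_int a / of_int b" "b > 0"
    by (metis Fract_of_int_quotient Rat_cases)
  have "of_int (b * D) * f i \<in> \<int>" if "i < Suc k" for i
  proof (cases "i = k")
    case True
    have "of_int (b * D) * f k = of_int (D * a)" using ab by simp
    then show ?thesis using True by (metis Ints_of_int)
  next
    case False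
    then have "of_int D * f i \<in> \<int>" using D(2) that by simp
    then have "of_int b * (of_int D * f i) \<in> \<int>" by (rule Ints_mult[OF Ints_of_int])
    then show ?thesis by (simp only: of_int_mult mult.assoc)
  qed
  then show ?case using D(1) ab(2) by (intro exI[of _ "b * D"]) auto
qed

section \<open>Subrings of the complex numbers and the Frobenius congruence\<close>

locale complex_subring =
  fixes R :: "complex set"
  assumes of_int_mem: "of_int k \<in> R"
    and add_mem: "a \<in> R \<Longrightarrow> b \<in> R \<Longrightarrow> a + b \<in> R"
    and mult_mem: "a \<in> R \<Longrightarrow> b \<in> R \<Longrightarrow> a * b \<in> R"
begin

lemma one_mem: "1 \<in> R" using of_int_mem[of 1] by simp
lemma zero_mem: "0 \<in> R" using of_int_mem[of 0] by simp
lemma of_nat_mem: "of_nat k \<in> R" using of_int_mem[of "int k"] by simp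
lemma uminus_mem: "a \<in> R \<Longrightarrow> - a \<in> R" using mult_mem[OF of_int_mem[of "-1"], of a] by simp

lemma power_mem: "a \<in> R \<Longrightarrow> a ^ k \<in> R"
  by (induction k) (auto simp: one_mem mult_mem)

lemma sum_mem: "(\<And>i. i \<in> A \<Longrightarrow> f i \<in> R) \<Longrightarrow> sum f A \<in> R"
  by (induction A rule: infinite_finite_induct) (auto simp: zero_mem add_mem)

lemma power_diff_factor:
  assumes "a \<in> R" "b \<in> R"
  shows "\<exists>c\<in>R. a ^ k - b ^ k = (a - b) * c"
proof (induction k)
  case 0
  show ?case using zero_mem by auto
next
  case (Suc k)
  then obtain c where c: "c \<in> R" "a ^ k - b ^ k = (a - b) * c" by blast
  have "a ^ Suc k - b ^ Suc k = a * (a ^ k - b ^ k) + (a - b) * b ^ k"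
    by (simp add: algebra_simps)
  also have "\<dots> = (a - b) * (a * c + b ^ k)"
    unfolding c(2) by (simp add: algebra_simps)
  finally show ?case
    using assms c(1) by (intro bexI[of _ "a * c + b ^ k"]) (auto intro!: add_mem mult_mem power_mem)
qed

text \<open>The inner binomial coefficients are multiples of \<open>p\<close>; dividing them by
  \<open>p\<close> leaves natural numbers, so the cofactor stays in \<open>R\<close>.\<close>

lemma frobenius_add:
  assumes "prime p" "a \<in> R" "b \<in> R"
  shows "\<exists>c\<in>R. (a + b) ^ p = a ^ p + b ^ p + of_nat p * c"
proof -
  have p: "p > 1" using assms(1) prime_gt_1_nat by blast
  define t where "t k = of_nat (p choose k) * a ^ k * b ^ (p - k)" for k
  define u where "u k = of_nat ((p choose k) div p) * a ^ k * b ^ (p - k)" for k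
  have t: "t k = of_nat p * u k" if "k \<in> {0<..<p}" for k
  proof -
    have "p choose k = p * ((p choose k) div p)"
      using that dvd_choose_prime[of k p] assms(1) by simp
    then have "of_nat (p choose k) = (of_nat p * of_nat ((p choose k) div p) :: complex)"
      by (metis of_nat_mult)
    then show ?thesis unfolding t_def u_def by simp
  qed
  have "{..p} = insert 0 (insert p {0<..<p})" using p by auto
  then have "(a + b) ^ p = t 0 + t p + (\<Sum>k\<in>{0<..<p}. t k)"
    unfolding binomial_ring using p by (simp add: t_def)
  also have "(\<Sum>k\<in>{0<..<p}. t k) = of_nat p * (\<Sum>k\<in>{0<..<p}. u k)"
    using t by (simp add: sum_distrib_left)
  also have "t 0 + t p = a ^ p + b ^ p" by (simp add: t_def)
  finally show ?thesis
    by (rule bexI) (auto simp: u_def intro!: sum_mem mult_mem power_mem of_nat_mem assms)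
qed

lemma frobenius_add_iterated:
  assumes "prime p" "a \<in> R" "b \<in> R"
  shows "\<exists>c\<in>R. (a + b) ^ (p ^ k) = a ^ (p ^ k) + b ^ (p ^ k) + of_nat p * c"
proof (induction k)
  case 0
  show ?case using zero_mem by auto
next
  case (Suc k)
  have p: "p > 0" using assms(1) prime_gt_0_nat by blast
  obtain c where c: "c \<in> R" "(a + b) ^ (p ^ k) = a ^ (p ^ k) + b ^ (p ^ k) + of_nat p * c"
    using Suc by blast
  obtain d where d: "d \<in> R"
    "(a ^ (p ^ k) + b ^ (p ^ k)) ^ p = (a ^ (p ^ k)) ^ p + (b ^ (p ^ k)) ^ p + of_nat p * d"
    using frobenius_add[OF assms(1) power_mem[OF assms(2)] power_mem[OF assms(3)]] by blast
  obtain e where e: "e \<in> R"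
    "(a ^ (p ^ k) + b ^ (p ^ k) + of_nat p * c) ^ p
       = (a ^ (p ^ k) + b ^ (p ^ k)) ^ p + (of_nat p * c) ^ p + of_nat p * e"
    using frobenius_add[OF assms(1) add_mem[OF power_mem[OF assms(2)] power_mem[OF assms(3)]]
        mult_mem[OF of_nat_mem c(1)]] by blast
  \<comment> \<open>The \<open>p\<close>-th power of the old error still carries a factor
    \<open>p\<close>, so all errors collect into one multiple of \<open>p\<close>.\<close>
  have "(of_nat p * c) ^ p = of_nat p * (c * (of_nat p * c) ^ (p - 1))"
    using p by (simp add: power_eq_if)
  moreover have pow: "x ^ (p ^ Suc k) = (x ^ (p ^ k)) ^ p" for x :: complex
    by (simp flip: power_mult add: mult.commute)
  ultimately have "(a + b) ^ (p ^ Suc k) = a ^ (p ^ Suc k) + b ^ (p ^ Suc k)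
      + of_nat p * (d + e + c * (of_nat p * c) ^ (p - 1))"
    unfolding pow c(2) e(2) d(2) by (simp only: distrib_left add.assoc add.left_commute add.commute)
  then show ?case
    by (rule bexI) (intro add_mem mult_mem power_mem of_nat_mem c d e)
qed

end

section \<open>Reduction at the prime above \<open>p\<close>\<close>

text \<open>The fixed \<open>D\<close> absorbs only boundedly many factors \<open>p\<close>: if
  \<open>p\<close> did not divide \<open>N\<close>, every power of \<open>p\<close> would divide
  \<open>D\<close>.\<close>

lemma prime_dvd_of_powers_dvd:
  fixes D N :: int
  assumes "prime p" "D > 0" "\<And>j. int p ^ j dvd D * N ^ (q * j)"
  shows "int p dvd N"
proof (rule ccontr)
  assume "\<not> int p dvd N"
  then have "coprime (int p) N" using assms(1) by (intro prime_imp_coprime) auto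
  then have "int p ^ j dvd D" for j
    using assms(3)[of j] coprime_dvd_mult_left_iff
    by (metis coprime_power_left_iff coprime_power_right_iff)
  then have "int p ^ nat D \<le> D" using assms(2) zdvd_imp_le by blast
  moreover have "nat D < p ^ nat D"
    using power_gt_expt[of p "nat D"] prime_ge_2_nat[OF assms(1)] by simp
  ultimately show False 
    using assms(2) by (simp add: nat_less_iff)
qed

text \<open>
  The ring \<open>R\<close> of multipliers of a lattice on which a rational functional has bounded
  denominators takes the place of the ring of integers of the cyclotomic field. Modulo
  \<open>1 + \<zeta>\<close> the vanishing sum becomes \<open>N = \<Sum>z\<in>A. (-1) ^ a z\<close>, and \<open>(1 + \<zeta>) ^ p ^ \<alpha>\<close> lies in \<open>p R\<close>.
\<close>

lemma vanishing_sum_mod_prime: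
  fixes \<zeta> :: complex and a :: "'a \<Rightarrow> nat"
  assumes p: "prime p" and \<zeta>: "\<zeta> ^ (p ^ \<alpha>) = -1"
    and A: "finite A" "(\<Sum>z\<in>A. \<zeta> ^ a z) = 0"
  shows "int p dvd (\<Sum>z\<in>A. (-1) ^ a z)"
proof -
  define q where "q = p ^ \<alpha>"
  define N :: int where "N = (\<Sum>z\<in>A. (-1) ^ a z)"
  have q: "q > 0" unfolding q_def using p prime_gt_0_nat by simp
  obtain l :: "complex \<Rightarrow> rat" where l1: "l 1 = 1" and ladd: "\<And>x y. l (x + y) = l x + l y"
    and lscale: "\<And>r x. l (of_rat r * x) = r * l x"
    using rat_functional_exists by blast
  have lint: "l (of_int k * x) = of_int k * l x" for k x
    using lscale[of "of_int k" x] by simp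
  obtain D :: int where D: "D > 0" "\<forall>i<2*q. of_int D * l (\<zeta> ^ i) \<in> \<int>"
    using common_denominator[of "2 * q" "\<lambda>i. l (\<zeta> ^ i)"] by blast
  \<comment> \<open>Powers of \<open>\<zeta>\<close> repeat with period \<open>2 * q\<close>, so
    finitely many denominators serve all exponents.\<close>
  have "\<zeta> ^ (2 * q) = 1" 
    using \<zeta> power_mult[of \<zeta> q 2] by (simp add: q_def mult.commute)
  then have "\<zeta> ^ (i mod (2 * q) + 2 * q * (i div (2 * q))) = \<zeta> ^ (i mod (2 * q))" for i
    by (simp only: power_add power_mult power_one mult_1_right)
  then have "\<zeta> ^ i = \<zeta> ^ (i mod (2 * q))" for i by simp
  moreover have "i mod (2 * q) < 2 * q" for i using q by simp
  ultimately have Dl: "of_int D * l (\<zeta> ^ i) \<in> \<int>" for i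
    using D(2) by metis
  \<comment> \<open>Letting \<open>i\<close> run over all exponents makes \<open>M\<close> stable
    under \<open>\<zeta>\<close>, so \<open>\<zeta>\<close> lies in \<open>R\<close>. Since 1 lies
    in \<open>M\<close>, the values of \<open>l\<close> on \<open>R\<close> have denominators
    dividing \<open>D\<close>.\<close>
  define M where "M = {v. \<forall>i. of_int D * l (v * \<zeta> ^ i) \<in> \<int>}"
  define R where "R = {w. \<forall>v\<in>M. w * v \<in> M}"
  interpret complex_subring R
  proof
    show "of_int k \<in> R" for k
      unfolding R_def M_def by (auto simp: mult.assoc lint mult.left_commute[of _ "of_int k"])
    show "a + b \<in> R" if "a \<in> R" "b \<in> R" for a b
      using that unfolding R_def M_def by (auto simp: ladd distrib_right distrib_left)
    show "a * b \<in> R" if "a \<in> R" "b \<in> R" for a b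
      using that unfolding R_def by (auto simp: mult.assoc)
  qed
  have "1 \<in> M" unfolding M_def using Dl by simp
  then have RD: "of_int D * l w \<in> \<int>" if "w \<in> R" for w
  proof -
    have "w * 1 \<in> M" using that \<open>1 \<in> M\<close> unfolding R_def by blast
    then show ?thesis unfolding M_def by (metis (mono_tags, lifting) mem_Collect_eq mult.right_neutral power_0)
  qed
  have "\<zeta> \<in> R" unfolding R_def M_def
    by (auto simp: mult.assoc mult.left_commute[of \<zeta>] simp flip: power_Suc)
  have "\<exists>c\<in>R. \<zeta> ^ k - (-1) ^ k = (\<zeta> - (-1)) * c" for k
    using power_diff_factor[OF \<open>\<zeta> \<in> R\<close>, of "-1"] uminus_mem[OF one_mem] by blast
  then obtain c where c: "\<And>k. c k \<in> R" "\<And>k. \<zeta> ^ k - (-1) ^ k = (\<zeta> - (-1)) * c k"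
    by metis
  define B where "B = - (\<Sum>z\<in>A. c (a z))"
  have "B \<in> R" unfolding B_def by (intro uminus_mem sum_mem c)
  have "of_int N = (\<Sum>z\<in>A. (-1) ^ a z) - (\<Sum>z\<in>A. \<zeta> ^ a z)"
    unfolding N_def A(2) by simp
  also have "\<dots> = - (\<Sum>z\<in>A. \<zeta> ^ a z - (-1) ^ a z)"
    by (simp add: sum_subtractf)
  also have "\<dots> = (1 + \<zeta>) * B"
    unfolding c(2) B_def by (simp add: sum_distrib_left add.commute)
  finally have N: "of_int N = (1 + \<zeta>) * B" .
  \<comment> \<open>The terms 1 and \<open>\<zeta> ^ q = -1\<close> cancel, so only the multiple of
    \<open>p\<close> survives.\<close>
  obtain e where e: "e \<in> R" "(1 + \<zeta>) ^ q = of_nat p * e"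
    using frobenius_add_iterated[OF p one_mem \<open>\<zeta> \<in> R\<close>, of \<alpha>] \<zeta> unfolding q_def by auto
  \<comment> \<open>\<open>N ^ (q * j)\<close> is \<open>p ^ j\<close> times an element of
    \<open>R\<close>; applying \<open>l\<close> costs only the factor \<open>D\<close>, whatever
    \<open>j\<close> is.\<close>
  have "int p ^ j dvd D * N ^ (q * j)" for j
  proof -
    define w where "w = (e * B ^ q) ^ j"
    have "w \<in> R" unfolding w_def by (intro power_mem mult_mem e \<open>B \<in> R\<close>)
    then obtain s where s: "of_int D * l w = of_int s" using RD Ints_cases by blast
    have "of_int (N ^ (q * j)) = ((1 + \<zeta>) ^ q * B ^ q) ^ j"
      by (simp add: N power_mult power_mult_distrib)
    also have "\<dots> = of_int (int p ^ j) * w"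
      unfolding e(2) w_def by (simp add: power_mult_distrib mult.assoc)
    finally have "l (of_int (N ^ (q * j)) * 1) = l (of_int (int p ^ j) * w)" by simp
    then have "of_int (N ^ (q * j)) = of_int (int p ^ j) * l w"
      unfolding lint l1 by simp
    then have "(of_int (D * N ^ (q * j)) :: rat) = of_int (int p ^ j * s)"
      using s by (simp add: algebra_simps)
    then have "D * N ^ (q * j) = int p ^ j * s" by (simp only: of_int_eq_iff)
    then show ?thesis by simp
  qed
  then show ?thesis unfolding N_def[symmetric] using prime_dvd_of_powers_dvd[OF p D(1)] by blast
qed

section \<open>Autocorrelations of sign functions on Boolean groups\<close>

text \<open>The odd factor is coprime to \<open>2 ^ k\<close>, so it divides
  \<open>p\<close>.\<close>

lemma odd_prod_prime_power2_cases:
  fixes p :: nat and a b :: int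
  assumes "prime p" "a * b = int p * 2 ^ k" "odd a" "a > 0"
  shows "(a = 1 \<and> b = int p * 2 ^ k) \<or> (a = int p \<and> b = 2 ^ k)"
proof -
  have "coprime a (2 ^ k)" using assms(3) by simp
  moreover have "a dvd int p * 2 ^ k" using assms(2) by (metis dvd_triv_left)
  ultimately have "a dvd int p" by (simp add: coprime_dvd_mult_left_iff)
  moreover have "prime (int p)" using assms(1) by simp
  ultimately have "a = 1 \<or> a = int p"
    using assms(4) by (metis prime_int_iff order_less_imp_le)
  then show ?thesis using assms(1,2) by (auto simp: prime_gt_0_nat)
qed

text \<open>For \<open>v = \<bar>u\<bar>\<close> and \<open>s = \<bar>t\<bar>\<close>, the numbers
  \<open>a = (s - v) / 2\<close> and \<open>b = (s + v) / 2\<close> have product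
  \<open>p * 2 ^ k\<close> and odd difference \<open>v\<close>, so one of them is odd. Size excludes
  every splitting but \<open>a = p\<close>, \<open>b = 2 ^ k\<close>. Then \<open>v\<close> and its
  square both equal \<open>2 ^ k - p\<close>, whence \<open>v = 1\<close>.\<close>

lemma odd_square_pair_imp_mersenne:
  fixes p k :: nat and u t :: int
  assumes p: "prime p" "odd p" and k: "k \<ge> 1"
    and u: "u\<^sup>2 = 2 ^ k - int p" and t: "t\<^sup>2 = u\<^sup>2 + int p * 2 ^ (k + 2)"
  shows "int p = 2 ^ k - 1"
proof -
  define v s where "v = \<bar>u\<bar>" and "s = \<bar>t\<bar>"
  have v2: "v\<^sup>2 = 2 ^ k - int p" and s2: "s\<^sup>2 = v\<^sup>2 + int p * 2 ^ (k + 2)"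
    using u t by (simp_all add: v_def s_def)
  have "odd (v\<^sup>2)" unfolding v2 using p(2) k by simp
  then have "odd v" by simp
  have "odd (s\<^sup>2)" unfolding s2 using \<open>odd v\<close> by simp
  then have "odd s" by simp
  have "v > 0" using \<open>odd v\<close> unfolding v_def by (cases "u = 0") auto
  have "p > 0" using p(1) prime_gt_0_nat by blast
  then have "v\<^sup>2 < s\<^sup>2" unfolding s2 by simp
  then have "v < s" by (rule power2_less_imp_less) (simp add: s_def)
  obtain a where a: "s - v = 2 * a" using \<open>odd s\<close> \<open>odd v\<close> by (metis even_diff even_add evenE)
  define b where "b = a + v"
  have s: "s = v + 2 * a" using a by simp
  have "a > 0" "b > a" using a \<open>v < s\<close> \<open>v > 0\<close> by (auto simp: b_def)
  have "4 * (a * b) = s\<^sup>2 - v\<^sup>2" unfolding s b_def by (simp add: power2_eq_square algebra_simps)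
  then have ab: "a * b = int p * 2 ^ k" unfolding s2 by simp
  have p3: "int p \<ge> 3" using p prime_ge_2_nat[OF p(1)] by (cases "p = 2") auto
  have "v \<le> v * v" using \<open>v > 0\<close> by simp
  then have vle: "v \<le> 2 ^ k - int p" using v2 by (simp add: power2_eq_square)
  have big: "int p * 2 ^ k \<ge> 3 * 2 ^ k" using p3 by simp
  have "v = 2 ^ k - int p"
  proof (cases "odd a")
    case True
    from odd_prod_prime_power2_cases[OF p(1) ab this \<open>a > 0\<close>]
    show ?thesis
    proof
      assume "a = 1 \<and> b = int p * 2 ^ k"
      moreover have "(2::int) ^ k \<ge> 1" by simp
      ultimately show ?thesis using big vle p3 unfolding b_def by linarith
    next
      assume "a = int p \<and> b = 2 ^ k"
      then show ?thesis unfolding b_def by simp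
    qed
  next
    case False
    then have "odd b" using \<open>odd v\<close> by (simp add: b_def)
    moreover have "b * a = int p * 2 ^ k" using ab by (simp add: mult.commute)
    ultimately have "(b = 1 \<and> a = int p * 2 ^ k) \<or> (b = int p \<and> a = 2 ^ k)"
      using \<open>a > 0\<close> \<open>b > a\<close> by (intro odd_prod_prime_power2_cases[OF p(1)]) auto
    then show ?thesis using \<open>a > 0\<close> \<open>b > a\<close> vle \<open>v > 0\<close> by linarith
  qed
  then have "v * v = v * 1" using v2 by (simp add: power2_eq_square)
  then have "v = 1" using \<open>v > 0\<close> by simp
  then show ?thesis using \<open>v = 2 ^ k - int p\<close> by simp
qed

section \<open>Boolean groups and their characters\<close>

locale boolean_group =
  fixes V :: "'a set" and add :: "'a \<Rightarrow> 'a \<Rightarrow> 'a" (infixl "\<oplus>" 65) and zero :: 'a ("\<zero>")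
  assumes finite_carrier: "finite V"
    and add_closed: "x \<in> V \<Longrightarrow> y \<in> V \<Longrightarrow> x \<oplus> y \<in> V"
    and zero_closed: "\<zero> \<in> V"
    and add_assoc: "x \<in> V \<Longrightarrow> y \<in> V \<Longrightarrow> z \<in> V \<Longrightarrow> (x \<oplus> y) \<oplus> z = x \<oplus> (y \<oplus> z)"
    and add_commute: "x \<in> V \<Longrightarrow> y \<in> V \<Longrightarrow> x \<oplus> y = y \<oplus> x"
    and add_zero: "x \<in> V \<Longrightarrow> \<zero> \<oplus> x = x"
    and add_self: "x \<in> V \<Longrightarrow> x \<oplus> x = \<zero>"
begin

lemma add_add_cancel: "x \<in> V \<Longrightarrow> y \<in> V \<Longrightarrow> x \<oplus> (x \<oplus> y) = y"
  by (simp add: add_assoc[symmetric] add_self add_zero)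

lemma add_eq_zero_iff: "x \<in> V \<Longrightarrow> y \<in> V \<Longrightarrow> x \<oplus> y = \<zero> \<longleftrightarrow> x = y"
  by (metis add_add_cancel add_self add_commute add_zero zero_closed)

lemma bij_betw_translate: "a \<in> V \<Longrightarrow> bij_betw (\<lambda>x. a \<oplus> x) V V"
  by (rule bij_betw_byWitness[where f' = "\<lambda>x. a \<oplus> x"]) (auto simp: add_add_cancel add_closed)

lemma sum_translate: "a \<in> V \<Longrightarrow> (\<Sum>x\<in>V. f (a \<oplus> x)) = sum f V"
  by (rule sum.reindex_bij_betw[OF bij_betw_translate])

text \<open>Every complex character of a Boolean group takes only the values 1 and -1; integer
  values keep the Fourier coefficients of sign functions in the integers.\<close>

definition sign_character :: "('a \<Rightarrow> int) \<Rightarrow> bool" where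
  "sign_character \<psi> \<longleftrightarrow> (\<forall>x\<in>V. \<psi> x = 1 \<or> \<psi> x = -1) \<and> (\<forall>x\<in>V. \<forall>y\<in>V. \<psi> (x \<oplus> y) = \<psi> x * \<psi> y)"

lemma sign_character_zero: "sign_character \<psi> \<Longrightarrow> \<psi> \<zero> = 1"
  unfolding sign_character_def
  by (metis add_zero zero_closed mult_cancel_left2 mult_minus1_right equation_minus_iff one_neq_neg_one)

lemma sign_character_mult:
  "sign_character \<psi> \<Longrightarrow> sign_character \<phi> \<Longrightarrow> sign_character (\<lambda>x. \<psi> x * \<phi> x)"
  unfolding sign_character_def by (fastforce simp: algebra_simps)

text \<open>Translation by \<open>a\<close> negates the sum.\<close>

lemma sum_nontrivial_character:
  assumes "sign_character \<psi>" "a \<in> V" "\<psi> a = -1"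
  shows "(\<Sum>x\<in>V. \<psi> x) = 0"
proof -
  have "(\<Sum>x\<in>V. \<psi> x) = (\<Sum>x\<in>V. \<psi> (a \<oplus> x))" by (rule sum_translate[OF assms(2), symmetric])
  also have "\<dots> = - (\<Sum>x\<in>V. \<psi> x)"
    using assms by (simp add: sign_character_def sum_negf)
  finally show ?thesis by simp
qed

section \<open>Autocorrelations: Fourier transform, congruence and signs\<close>

definition autocorr :: "('a \<Rightarrow> int) \<Rightarrow> 'a \<Rightarrow> int" where
  "autocorr g x = (\<Sum>z\<in>V. g z * g (x \<oplus> z))"

lemma autocorr_zero:
  assumes "\<And>z. z \<in> V \<Longrightarrow> g z = 1 \<or> g z = -1"
  shows "autocorr g \<zero> = int (card V)"
proof -
  have "g z * g (\<zero> \<oplus> z) = 1" if "z \<in> V" for z using assms[OF that] that by (auto simp: add_zero)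
  then show ?thesis unfolding autocorr_def by simp
qed

lemma abs_autocorr_le:
  assumes "\<And>z. z \<in> V \<Longrightarrow> g z = 1 \<or> g z = -1" and "x \<in> V"
  shows "\<bar>autocorr g x\<bar> \<le> int (card V)"
proof -
  have "\<bar>g z * g (x \<oplus> z)\<bar> \<le> 1" if "z \<in> V" for z
    using assms(1)[OF that] assms(1)[OF add_closed[OF assms(2) that]] by auto
  then have "(\<Sum>z\<in>V. \<bar>g z * g (x \<oplus> z)\<bar>) \<le> (\<Sum>z\<in>V. 1)" by (rule sum_mono)
  then have "(\<Sum>z\<in>V. \<bar>g z * g (x \<oplus> z)\<bar>) \<le> int (card V)" by simp
  then show ?thesis unfolding autocorr_def 
    using sum_abs[of "\<lambda>z. g z * g (x \<oplus> z)" V] by linarith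
qed

text \<open>The Wiener-Khinchin identity: since
  \<open>\<psi> x = \<psi> z * \<psi> (z \<oplus> x)\<close>, the double sum factors after
  translating \<open>x\<close> by \<open>z\<close>.\<close>

lemma character_sum_squared:
  assumes "sign_character \<psi>"
  shows "(\<Sum>x\<in>V. \<psi> x * autocorr g x) = (\<Sum>x\<in>V. \<psi> x * g x)\<^sup>2"
proof -
  have sq: "\<psi> z * \<psi> z = 1" if "z \<in> V" for z using assms that unfolding sign_character_def by auto
  have "(\<Sum>x\<in>V. \<psi> x * autocorr g x) = (\<Sum>x\<in>V. \<Sum>z\<in>V. \<psi> x * (g z * g (x \<oplus> z)))"
    by (simp add: autocorr_def sum_distrib_left)
  also have "\<dots> = (\<Sum>z\<in>V. \<Sum>x\<in>V. \<psi> x * (g z * g (x \<oplus> z)))" by (rule sum.swap)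
  also have "\<dots> = (\<Sum>z\<in>V. \<Sum>x\<in>V. \<psi> z * g z * (\<psi> (z \<oplus> x) * g (z \<oplus> x)))"
  proof (intro sum.cong refl)
    fix z x assume zx: "z \<in> V" "x \<in> V"
    have "\<psi> (z \<oplus> x) = \<psi> z * \<psi> x" using assms zx unfolding sign_character_def by blast
    then show "\<psi> x * (g z * g (x \<oplus> z)) = \<psi> z * g z * (\<psi> (z \<oplus> x) * g (z \<oplus> x))"
      using sq[OF zx(1)] add_commute[OF zx(2,1)] by (simp add: algebra_simps) 
  qed
  also have "\<dots> = (\<Sum>z\<in>V. \<psi> z * g z * (\<Sum>x\<in>V. \<psi> x * g x))"
    by (intro sum.cong refl) (simp add: sum_distrib_left[symmetric] sum_translate[where f = "\<lambda>x. \<psi> x * g x"])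
  also have "\<dots> = (\<Sum>x\<in>V. \<psi> x * g x)\<^sup>2" by (simp add: sum_distrib_right power2_eq_square)
  finally show ?thesis .
qed

text \<open>The orbits of translation by a nonzero \<open>x\<close> are pairs.\<close>

lemma even_card_translation_invariant:
  assumes "x \<in> V" "x \<noteq> \<zero>" "A \<subseteq> V" "\<And>z. z \<in> A \<Longrightarrow> x \<oplus> z \<in> A"
  shows "even (card A)"
proof -
  define C where "C = (\<lambda>z. {z, x \<oplus> z}) ` A"
  have A: "finite A" using assms(3) finite_carrier finite_subset by blast
  have U: "\<Union>C = A" unfolding C_def using assms(4) by auto
  have "2 * card C = card (\<Union>C)"
  proof (rule card_partition)
    show "finite C" unfolding C_def using A by simp
    show "finite (\<Union>C)" using U A by simp
    show "card c = 2" if c: "c \<in> C" for c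
    proof -
      obtain z where z: "z \<in> A" "c = {z, x \<oplus> z}" using c unfolding C_def by blast
      then have "z \<in> V" using assms(3) by blast
      then have "z \<noteq> x \<oplus> z" using assms(1,2)
        by (metis add_add_cancel add_self add_commute)
      then show ?thesis using z(2) by simp
    qed
    show "c \<inter> d = {}" if c: "c \<in> C" and d: "d \<in> C" and ne: "c \<noteq> d" for c d
    proof -
      obtain z where z: "z \<in> A" "c = {z, x \<oplus> z}" using c unfolding C_def by blast
      obtain w where w: "w \<in> A" "d = {w, x \<oplus> w}" using d unfolding C_def by blast
      have "z \<in> V" "w \<in> V" using z(1) w(1) assms(3) by auto
      then show ?thesis using ne z(2) w(2) add_add_cancel[OF assms(1)]
        by (metis disjoint_iff insertE insert_commute singletonD)
    qed
  qed
  then show ?thesis using U by (metis dvd_triv_left)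
qed

text \<open>The expression is the sum of \<open>(g z - 1) * (g (x \<oplus> z) - 1)\<close>. Each
  term is 0 or 4, and the places with value 4 are stable under translation by \<open>x\<close>,
  hence even in number.\<close>

lemma autocorr_mod_8:
  assumes g: "\<And>z. z \<in> V \<Longrightarrow> g z = 1 \<or> g z = -1" and x: "x \<in> V" "x \<noteq> \<zero>"
  shows "8 dvd autocorr g x - 2 * sum g V + int (card V)"
proof -
  define A where "A = {z \<in> V. g z = -1 \<and> g (x \<oplus> z) = -1}"
  have "even (card A)"
    by (rule even_card_translation_invariant[OF x])
       (auto simp: A_def add_closed add_add_cancel x(1))
  have "(g z - 1) * (g (x \<oplus> z) - 1) = (if z \<in> A then 4 else 0)" if "z \<in> V" for z
    using g[OF that] g[OF add_closed[OF x(1) that]] that by (auto simp: A_def)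
  then have "(\<Sum>z\<in>V. (g z - 1) * (g (x \<oplus> z) - 1)) = (\<Sum>z\<in>V. if z \<in> A then 4 else 0)"
    by (intro sum.cong) auto
  also have "\<dots> = 4 * int (card A)"
    using finite_carrier by (simp add: sum.If_cases A_def Int_def)
  finally have *: "(\<Sum>z\<in>V. (g z - 1) * (g (x \<oplus> z) - 1)) = 4 * int (card A)" .
  have "(\<Sum>z\<in>V. (g z - 1) * (g (x \<oplus> z) - 1))
      = (\<Sum>z\<in>V. g z * g (x \<oplus> z) - g z - g (x \<oplus> z) + 1)"
    by (intro sum.cong) (auto simp: algebra_simps)
  also have "\<dots> = autocorr g x - sum g V - (\<Sum>z\<in>V. g (x \<oplus> z)) + int (card V)"
    by (simp add: sum.distrib sum_subtractf autocorr_def)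
  also have "\<dots> = autocorr g x - 2 * sum g V + int (card V)"
    by (simp add: sum_translate[OF x(1)])
  finally have "autocorr g x - 2 * sum g V + int (card V) = 4 * int (card A)" using * by simp
  moreover from \<open>even (card A)\<close> obtain k where "card A = 2 * k" by blast
  ultimately show ?thesis by simp
qed

text \<open>
  Summed over \<open>z\<close>, the inequality \<open>a * b \<ge> a + b - 1\<close> for signs \<open>a\<close>, \<open>b\<close> shows that signs of
  autocorrelations above half the group order multiply.
\<close>

lemma autocorr_large_sign_mult:
  assumes g: "\<And>z. z \<in> V \<Longrightarrow> g z = 1 \<or> g z = -1"
    and xy: "x \<in> V" "y \<in> V" and e: "e = 1 \<or> e = -1" "d = 1 \<or> d = -1"
    and "2 * (e * autocorr g x) > int (card V)" "2 * (d * autocorr g y) > int (card V)"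
  shows "e * d * autocorr g (x \<oplus> y) > 0"
proof -
  have "e * (g z * g (x \<oplus> z)) + d * (g (x \<oplus> z) * g (y \<oplus> (x \<oplus> z))) - 1
      \<le> e * d * (g z * g ((x \<oplus> y) \<oplus> z))" if z: "z \<in> V" for z
  proof -
    have eq: "(x \<oplus> y) \<oplus> z = y \<oplus> (x \<oplus> z)" using xy z by (metis add_assoc add_commute)
    show ?thesis unfolding eq
      using g[OF z] g[OF add_closed[OF xy(1) z]] g[OF add_closed[OF xy(2) add_closed[OF xy(1) z]]] e
      by auto
  qed
  then have "(\<Sum>z\<in>V. e * (g z * g (x \<oplus> z)) + d * (g (x \<oplus> z) * g (y \<oplus> (x \<oplus> z))) - 1)
      \<le> (\<Sum>z\<in>V. e * d * (g z * g ((x \<oplus> y) \<oplus> z)))" by (rule sum_mono)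
  then have "e * autocorr g x + d * (\<Sum>z\<in>V. g (x \<oplus> z) * g (y \<oplus> (x \<oplus> z))) - int (card V)
      \<le> e * d * autocorr g (x \<oplus> y)"
    by (simp add: autocorr_def sum.distrib sum_subtractf sum_distrib_left mult.assoc)
  moreover have "(\<Sum>z\<in>V. g (x \<oplus> z) * g (y \<oplus> (x \<oplus> z))) = autocorr g y"
    unfolding autocorr_def by (rule sum_translate[OF xy(1), where f = "\<lambda>z. g z * g (y \<oplus> z)"])
  ultimately show ?thesis using assms(6,7) by simp
qed

lemma sum_remove_zero: "(\<Sum>x\<in>V. f x) = f \<zero> + (\<Sum>x\<in>V - {\<zero>}. f x)"
  using sum.remove[OF finite_carrier zero_closed] .

text \<open>Otherwise the trivial character gives a square equal to \<open>2 ^ n\<close>, whose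
  2-adic valuation \<open>n\<close> is odd.\<close>

lemma exists_nonzero_autocorr:
  assumes g: "\<And>z. z \<in> V \<Longrightarrow> g z = 1 \<or> g z = -1"
    and n: "card V = 2 ^ n" "odd n"
  shows "\<exists>x\<in>V. x \<noteq> \<zero> \<and> autocorr g x \<noteq> 0"
proof (rule ccontr)
  assume "\<not> ?thesis"
  then have 0: "(\<Sum>x\<in>V - {\<zero>}. autocorr g x) = 0" by (intro sum.neutral) auto
  have "sign_character (\<lambda>_. 1)" by (simp add: sign_character_def)
  from character_sum_squared[OF this, of g] have "(sum g V)\<^sup>2 = (\<Sum>x\<in>V. autocorr g x)" by simp
  also have "\<dots> = 2 ^ n" using sum_remove_zero[of "autocorr g"] 0 autocorr_zero[OF g] n(1) by simp
  finally have S: "(sum g V)\<^sup>2 = 2 ^ n" .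
  then have "sum g V \<noteq> 0" by auto
  have "multiplicity 2 ((sum g V)\<^sup>2) = 2 * multiplicity 2 (sum g V)"
    using \<open>sum g V \<noteq> 0\<close> by (simp add: prime_elem_multiplicity_power_distrib)
  moreover have "multiplicity 2 ((sum g V)\<^sup>2) = n"
    unfolding S by (rule multiplicity_same_power) auto
  ultimately show False using n(2) by simp
qed

lemma sgn_autocorr_character:
  assumes g: "\<And>z. z \<in> V \<Longrightarrow> g z = 1 \<or> g z = -1"
    and large: "\<And>x. x \<in> V \<Longrightarrow> 2 * \<bar>autocorr g x\<bar> > int (card V)"
  shows "sign_character (\<lambda>x. sgn (autocorr g x))"
proof -
  have sgn: "sgn (autocorr g x) = 1 \<or> sgn (autocorr g x) = -1" if "x \<in> V" for x
    using large[OF that] by (auto simp: sgn_if)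
  have "sgn (autocorr g (x \<oplus> y)) = sgn (autocorr g x) * sgn (autocorr g y)"
    if x: "x \<in> V" and y: "y \<in> V" for x y
  proof -
    have "sgn (autocorr g x) * sgn (autocorr g y) * autocorr g (x \<oplus> y) > 0"
      by (rule autocorr_large_sign_mult[OF g x y sgn[OF x] sgn[OF y]])
         (use large[OF x] large[OF y] in \<open>simp_all add: sgn_mult_self_eq abs_sgn mult.commute\<close>)
    then show ?thesis using sgn[OF x] sgn[OF y] by (auto simp: sgn_if)
  qed
  then show ?thesis using sgn unfolding sign_character_def by blast
qed

section \<open>The bound on a prime dividing all nontrivial autocorrelations\<close>

text \<open>The character \<open>\<psi>\<close> can be any nontrivial one: it supplies a second
  Fourier coefficient to compare with the extremal one. The conjunct \<open>n \<ge> 3\<close> makes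
  the subtractions in the exponents genuine.\<close>

theorem prime_dvd_autocorr_bound:
  assumes g: "\<And>z. z \<in> V \<Longrightarrow> g z = 1 \<or> g z = -1"
    and n: "card V = 2 ^ n" "odd n"
    and p: "prime p" "odd p"
    and dvd: "\<And>x. x \<in> V \<Longrightarrow> x \<noteq> \<zero> \<Longrightarrow> int p dvd autocorr g x"
    and \<psi>: "sign_character \<psi>" "a \<in> V" "\<psi> a = -1"
  shows "n \<ge> 3 \<and> (p < 2 ^ (n - 3) \<or> int p = 2 ^ (n - 2) - 1)"
proof -
  define r where "r = autocorr g"
  define S where "S = sum g V"
  have p3: "p \<ge> 3" using p prime_ge_2_nat[OF p(1)] by (cases "p = 2") auto
  have mod8: "8 dvd r x - 2 * S + 2 ^ n" if "x \<in> V" "x \<noteq> \<zero>" for x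
    using autocorr_mod_8[OF g that] n(1) unfolding r_def S_def by simp
  have bound: "\<bar>r x\<bar> \<le> 2 ^ n" if "x \<in> V" for x
    using abs_autocorr_le[OF g that] n(1) unfolding r_def by simp
  have "\<exists>x\<in>V. x \<noteq> \<zero> \<and> r x \<noteq> 0"
    unfolding r_def by (rule exists_nonzero_autocorr[OF g n])
  then obtain x where x: "x \<in> V" "x \<noteq> \<zero>" "r x \<noteq> 0" by blast
  have even_n: "even ((2::int) ^ n)" using odd_pos[OF n(2)] by simp
  have "n \<ge> 3"
  proof (rule ccontr)
    assume "\<not> n \<ge> 3"
    then have "n = 0 \<or> n = 1 \<or> n = 2" by linarith
    then have "n = 1" using n(2) by auto
    \<comment> \<open>For \<open>n = 1\<close> parity suffices: \<open>2 * p\<close> divides a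
      nonzero number of absolute value at most 2.\<close>
    have "even (r x - 2 * S + 2 ^ n)" using mod8[OF x(1,2)] by (rule dvd_trans[of 2 8, rotated]) simp
    then have "even (r x)" using even_n by simp
    moreover have "int p dvd r x" using dvd[OF x(1,2)] by (simp add: r_def)
    moreover have "coprime 2 (int p)" using p(2) by simp
    ultimately have "2 * int p dvd r x" by (simp add: divides_mult)
    then have "2 * int p \<le> \<bar>r x\<bar>" using dvd_imp_le_int[OF x(3)] by fastforce
    then show False using bound[OF x(1)] p3 \<open>n = 1\<close> by simp
  qed
  \<comment> \<open>The threshold for \<open>p\<close> is an eighth of the group order.\<close>
  define q :: int where "q = 2 ^ (n - 3)"
  have N: "2 ^ n = 8 * q"
    unfolding q_def using \<open>n \<ge> 3\<close> power_add[of "2::int" 3 "n - 3"] by simp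
  have "even S"
  proof -
    have "S - 2 ^ n = (\<Sum>z\<in>V. g z - 1)" unfolding S_def using n(1) by (simp add: sum_subtractf)
    moreover have "even (\<Sum>z\<in>V. g z - 1)" by (rule dvd_sum) (use g in force)
    ultimately have "even (S - 2 ^ n)" by simp
    then show ?thesis using even_n by simp
  qed
  then obtain s where s: "S = 2 * s" by blast
  \<comment> \<open>As \<open>S = 2 * s\<close> and 8 divides \<open>2 ^ n\<close>, the congruence
    modulo 8 makes \<open>r y\<close> four times a number of the parity of \<open>s\<close>;
    dividing by the odd \<open>p\<close> keeps that parity.\<close>
  have quarter: "\<exists>k. r y = 4 * int p * k \<and> even (k - s)" if y: "y \<in> V" "y \<noteq> \<zero>" for y
  proof -
    obtain j where j: "r y - 2 * S + 2 ^ n = 8 * j" using mod8[OF y] by blast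
    have r4: "r y = 4 * (2 * j + s - 2 * q)" using j unfolding s N by simp
    have "int p dvd 4 * (2 * j + s - 2 * q)" using dvd[OF y] unfolding r4[symmetric] by (simp add: r_def)
    moreover have "coprime (int p) 4" using p(2) coprime_power_right_iff[of "int p" 2 2] by simp
    ultimately have "int p dvd 2 * j + s - 2 * q" using coprime_dvd_mult_right_iff by blast
    then obtain k where k: "2 * j + s - 2 * q = int p * k" by blast
    have "even (int p * k - s)" unfolding k[symmetric] by simp
    then have "even (k - s)" using p(2) by simp
    moreover have "r y = 4 * int p * k" using r4 k by simp
    ultimately show ?thesis by blast
  qed
  \<comment> \<open>The power \<open>q\<close> is 1 or even, so the case \<open>p \<ge> q\<close>
    becomes strict.\<close>
  have "int p \<noteq> q"
  proof (cases "n = 3")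
    case True
    then show ?thesis using p3 by (simp add: q_def)
  next
    case False
    then have "even q" using \<open>n \<ge> 3\<close> by (simp add: q_def)
    then show ?thesis using p(2) by auto
  qed
  show ?thesis
  proof (cases "int p < q")
    case True
    then have "p < 2 ^ (n - 3)" unfolding q_def by (metis of_nat_less_iff of_nat_numeral of_nat_power)
    then show ?thesis using \<open>n \<ge> 3\<close> by blast
  next
    case False
    then have pq: "int p > q" using \<open>int p \<noteq> q\<close> by simp
    \<comment> \<open>A quotient of absolute value 2 or more would give at least
      \<open>8 * p\<close>, beyond the bound \<open>8 * q\<close>.\<close>
    have k1: "\<bar>k\<bar> \<le> 1" if "r y = 4 * int p * k" "y \<in> V" for y k
    proof (rule ccontr)
      assume "\<not> \<bar>k\<bar> \<le> 1"
      then have "4 * int p * 2 \<le> 4 * int p * \<bar>k\<bar>" by (intro mult_left_mono) auto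
      then show False using bound[OF that(2)] pq unfolding that(1) N by (simp add: abs_mult)
    qed
    have "odd s"
    proof
      assume "even s"
      obtain k where "r x = 4 * int p * k" "even (k - s)" using quarter[OF x(1,2)] by blast
      then show False using \<open>even s\<close> k1[OF _ x(1), of k] x(3)
        by (cases "k = 0") (auto simp: abs_le_iff elim!: evenE)
    qed
    have r: "\<bar>r y\<bar> = 4 * int p" if y: "y \<in> V" "y \<noteq> \<zero>" for y
    proof -
      obtain k where k: "r y = 4 * int p * k" "even (k - s)" using quarter[OF y] by blast
      then have "odd k" using \<open>odd s\<close> by simp
      then have "\<bar>k\<bar> = 1" using k1[OF k(1) y(1)] by (cases "k = 0") auto
      then show ?thesis unfolding k(1) by (simp add: abs_mult)
    qed
    have r0: "r \<zero> = 8 * q" using autocorr_zero[OF g] n(1) N by (simp add: r_def)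
    have q: "q > 0" by (simp add: q_def)
    define e where "e = (\<lambda>x. sgn (r x))"
    \<comment> \<open>Away from zero this is \<open>8 * p > 8 * q\<close>, where strictness
      matters.\<close>
    have "2 * \<bar>r y\<bar> > int (card V)" if "y \<in> V" for y
      using r[OF that] r0 pq q N n(1) by (cases "y = \<zero>") auto
    then have e: "sign_character e"
      unfolding e_def r_def by (intro sgn_autocorr_character g)
    have er: "e y * r y = \<bar>r y\<bar>" for y by (simp add: e_def abs_sgn mult.commute)
    \<comment> \<open>\<open>T\<close> is the coefficient at \<open>e\<close>, where all terms of
      the transform of \<open>r\<close> become positive. \<open>U\<close> is the one at the product
      of \<open>\<psi>\<close> and \<open>e\<close>, where the nonzero arguments contribute
      \<open>-4 * p\<close> in total.\<close>
    define T where "T = (\<Sum>x\<in>V. e x * g x)"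
    define U where "U = (\<Sum>x\<in>V. \<psi> x * e x * g x)"
    have "T\<^sup>2 = (\<Sum>x\<in>V. \<bar>r x\<bar>)"
      using character_sum_squared[OF e, of g] er by (simp add: T_def r_def)
    also have "\<dots> = 8 * q + (\<Sum>x\<in>V - {\<zero>}. 4 * int p)"
      unfolding sum_remove_zero[of "\<lambda>x. \<bar>r x\<bar>"] using r r0 q by simp
    also have "\<dots> = 8 * q + 4 * int p * (8 * q - 1)"
    proof -
      have "int (card (V - {\<zero>})) = 8 * q - 1"
        using finite_carrier zero_closed n(1) N by (simp add: card_Diff_singleton of_nat_diff)
      then show ?thesis by simp
    qed
    finally have T: "T\<^sup>2 = 8 * q + 4 * int p * (8 * q - 1)" .
    have "U\<^sup>2 = (\<Sum>x\<in>V. \<psi> x * \<bar>r x\<bar>)"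
      using character_sum_squared[OF sign_character_mult[OF \<psi>(1) e], of g] er
      by (simp add: U_def r_def mult.assoc)
    also have "\<dots> = 8 * q + (\<Sum>x\<in>V - {\<zero>}. \<psi> x * (4 * int p))"
      unfolding sum_remove_zero[of "\<lambda>x. \<psi> x * \<bar>r x\<bar>"] using r r0 q sign_character_zero[OF \<psi>(1)] by simp
    also have "(\<Sum>x\<in>V - {\<zero>}. \<psi> x * (4 * int p)) = (\<Sum>x\<in>V - {\<zero>}. \<psi> x) * (4 * int p)"
      by (rule sum_distrib_right[symmetric])
    also have "(\<Sum>x\<in>V - {\<zero>}. \<psi> x) = -1"
      using sum_nontrivial_character[OF \<psi>] sum_remove_zero[of \<psi>] sign_character_zero[OF \<psi>(1)]
      by simp
    finally have U: "U\<^sup>2 = 8 * q - 4 * int p" by simp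
    \<comment> \<open>Subtracting the squares gives \<open>32 * p * q\<close>; halving
      \<open>T\<close> and \<open>U\<close> divides this by 4 and leaves
      \<open>p * 2 ^ n\<close>.\<close>
    have "even (T\<^sup>2)" "even (U\<^sup>2)" unfolding T U by simp_all
    then obtain t u where t: "T = 2 * t" and u: "U = 2 * u" by (auto elim!: evenE)
    have k2: "(2::int) ^ (n - 2) = 2 * q"
      unfolding q_def using \<open>n \<ge> 3\<close> by (simp flip: power_Suc add: Suc_diff_le)
    have "int p = 2 ^ (n - 2) - 1"
    proof (rule odd_square_pair_imp_mersenne[OF p])
      show "n - 2 \<ge> 1" using \<open>n \<ge> 3\<close> by simp
      show u2: "u\<^sup>2 = 2 ^ (n - 2) - int p" using U unfolding u k2 by simp
      have n2: "n - 2 + 2 = n" using \<open>n \<ge> 3\<close> by simp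
      show "t\<^sup>2 = u\<^sup>2 + int p * 2 ^ (n - 2 + 2)"
        using T unfolding t u2 k2 n2 N by (simp add: algebra_simps)
    qed
    then show ?thesis using \<open>n \<ge> 3\<close> by blast
  qed
qed

end

section \<open>Generalized bent functions\<close>

definition vec_add :: "nat \<Rightarrow> (nat \<Rightarrow> int) \<Rightarrow> (nat \<Rightarrow> int) \<Rightarrow> nat \<Rightarrow> int" where
  "vec_add n x y = (\<lambda>i\<in>{..<n}. (x i + y i) mod 2)"

definition vec_zero :: "nat \<Rightarrow> nat \<Rightarrow> int" where
  "vec_zero n = (\<lambda>i\<in>{..<n}. 0)"

text \<open>The integer form of the sign \<open>(-1) powi Z2_inner n y x\<close>, so that it can
  serve as a \<open>sign_character\<close>.\<close>

definition vec_char :: "nat \<Rightarrow> (nat \<Rightarrow> int) \<Rightarrow> (nat \<Rightarrow> int) \<Rightarrow> int" where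
  "vec_char n y x = (if even (\<Sum>i<n. y i * x i) then 1 else -1)"

lemma Z2_vec_eq: "Z2_vec n = {..<n} \<rightarrow>\<^sub>E {0, 1}"
  unfolding Z2_vec_def residue_ring_def by (intro PiE_cong) auto

lemma Z2_vec_cases: "x \<in> Z2_vec n \<Longrightarrow> i < n \<Longrightarrow> x i = 0 \<or> x i = 1"
  unfolding Z2_vec_eq by (auto dest: PiE_mem)

lemma Z2_vec_eqI:
  "x \<in> Z2_vec n \<Longrightarrow> y \<in> Z2_vec n \<Longrightarrow> (\<And>i. i < n \<Longrightarrow> x i = y i) \<Longrightarrow> x = y"
  unfolding Z2_vec_eq by (rule PiE_ext) auto

lemma card_Z2_vec: "card (Z2_vec n) = 2 ^ n"
  unfolding Z2_vec_eq by (simp add: card_PiE numeral_2_eq_2)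

lemma vec_add_closed: "vec_add n x y \<in> Z2_vec n"
  unfolding vec_add_def Z2_vec_eq by (auto intro!: restrict_PiE simp: mod_2_eq_odd)

interpretation Z2: boolean_group "Z2_vec n" "vec_add n" "vec_zero n" for n
proof
  show "finite (Z2_vec n)" unfolding Z2_vec_eq by (intro finite_PiE) auto
  show z: "vec_zero n \<in> Z2_vec n" unfolding vec_zero_def Z2_vec_eq by auto
  show "vec_add n x y \<in> Z2_vec n" for x y by (rule vec_add_closed)
  show "vec_add n (vec_add n x y) z = vec_add n x (vec_add n y z)" for x y z
    by (rule Z2_vec_eqI[of _ n]) (simp_all add: vec_add_closed, simp add: vec_add_def mod_simps add.assoc)
  show "vec_add n x y = vec_add n y x" for x y
    by (simp add: vec_add_def add.commute)
  show "vec_add n (vec_zero n) x = x" if "x \<in> Z2_vec n" for x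
    using Z2_vec_cases[OF that] that
    by (intro Z2_vec_eqI[of _ n] vec_add_closed) (force simp: vec_add_def vec_zero_def)+
  show "vec_add n x x = vec_zero n" if "x \<in> Z2_vec n" for x
    by (intro Z2_vec_eqI[of _ n] vec_add_closed z) (simp add: vec_add_def vec_zero_def flip: mult_2)
qed

lemma vec_char_commute: "vec_char n y x = vec_char n x y"
  by (simp add: vec_char_def mult.commute)

text \<open>Reducing coordinates modulo 2 changes the integer inner product by an even
  amount.\<close>

lemma vec_char_add: "vec_char n y (vec_add n x z) = vec_char n y x * vec_char n y z"
proof -
  have "(\<Sum>i<n. y i * vec_add n x z i) - ((\<Sum>i<n. y i * x i) + (\<Sum>i<n. y i * z i))
      = (\<Sum>i<n. y i * ((x i + z i) mod 2 - (x i + z i)))"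
    by (simp add: vec_add_def algebra_simps sum.distrib sum_subtractf)
  moreover have "even (\<Sum>i<n. y i * ((x i + z i) mod 2 - (x i + z i)))"
    by (intro dvd_sum dvd_mult) (simp add: mod_2_eq_odd)
  ultimately have "even ((\<Sum>i<n. y i * vec_add n x z i) - ((\<Sum>i<n. y i * x i) + (\<Sum>i<n. y i * z i)))"
    by (simp only:)
  then show ?thesis by (auto simp: vec_char_def)
qed

lemma sign_character_vec_char: "Z2.sign_character n (vec_char n y)"
  unfolding Z2.sign_character_def by (simp add: vec_char_add) (simp add: vec_char_def)

lemma vec_char_Z2_inner: "(-1) powi Z2_inner n y x = (of_int (vec_char n y x) :: complex)"
  by (simp add: Z2_inner_def vec_char_def mod_2_eq_odd)

definition unit_vec :: "nat \<Rightarrow> nat \<Rightarrow> nat \<Rightarrow> int" where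
  "unit_vec n j = (\<lambda>i\<in>{..<n}. if i = j then 1 else 0)"

lemma unit_vec_mem: "unit_vec n j \<in> Z2_vec n"
  unfolding unit_vec_def Z2_vec_eq by auto

lemma vec_char_unit_vec:
  assumes "j < n"
  shows "vec_char n y (unit_vec n j) = (if even (y j) then 1 else -1)"
proof -
  have "(\<Sum>i<n. y i * unit_vec n j i) = (\<Sum>i<n. if i = j then y j else 0)"
    by (intro sum.cong) (auto simp: unit_vec_def)
  then show ?thesis using assms by (simp add: vec_char_def)
qed

text \<open>Orthogonality of characters: by symmetry the summand is a character in \<open>y\<close>,
  and a unit vector at a coordinate where \<open>u\<close> is 1 shows that it is nontrivial.\<close>

lemma sum_vec_char:
  assumes "u \<in> Z2_vec n"
  shows "(\<Sum>y\<in>Z2_vec n. vec_char n y u) = (if u = vec_zero n then 2 ^ n else 0)"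
proof (cases "u = vec_zero n")
  case True
  then have "vec_char n y u = 1" for y by (simp add: vec_char_def vec_zero_def)
  then show ?thesis using True by (simp add: card_Z2_vec)
next
  case False
  then obtain j where j: "j < n" "u j \<noteq> vec_zero n j"
    using Z2_vec_eqI[OF assms Z2.zero_closed] by blast
  then have "u j = 1" using Z2_vec_cases[OF assms j(1)] by (auto simp: vec_zero_def)
  then have "vec_char n u (unit_vec n j) = -1" by (simp add: vec_char_unit_vec[OF j(1)])
  from Z2.sum_nontrivial_character[OF sign_character_vec_char unit_vec_mem this]
  show ?thesis using False by (simp add: vec_char_commute[of n _ u])
qed

section \<open>Fourier inversion for a flat spectrum\<close>

text \<open>The constant squared modulus is weighted by the character at \<open>t\<close> and summed
  over \<open>y\<close>. This gives 0 because \<open>t\<close> is nonzero, while orthogonality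
  leaves only the terms with \<open>z = vec_add n t x\<close>.\<close>

lemma flat_spectrum_autocorr_zero:
  fixes w :: "(nat \<Rightarrow> int) \<Rightarrow> complex"
  assumes flat: "\<And>y. y \<in> Z2_vec n \<Longrightarrow> (cmod (\<Sum>x\<in>Z2_vec n. w x * of_int (vec_char n y x)))\<^sup>2 = c"
    and t: "t \<in> Z2_vec n" "t \<noteq> vec_zero n"
  shows "(\<Sum>x\<in>Z2_vec n. w x * cnj (w (vec_add n t x))) = 0"
proof -
  let ?V = "Z2_vec n"
  define F where "F y = (\<Sum>x\<in>?V. w x * of_int (vec_char n y x))" for y
  have sq: "F y * cnj (F y) = of_real c" if "y \<in> ?V" for y
    using flat[OF that] unfolding F_def[symmetric] by (metis complex_norm_square)
  have inner: "(\<Sum>z\<in>?V. w x * cnj (w z) * of_int (\<Sum>y\<in>?V. vec_char n y (vec_add n (vec_add n t x) z)))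
      = 2 ^ n * (w x * cnj (w (vec_add n t x)))" if x: "x \<in> ?V" for x
  proof -
    have "(\<Sum>z\<in>?V. w x * cnj (w z) * of_int (\<Sum>y\<in>?V. vec_char n y (vec_add n (vec_add n t x) z)))
       = (\<Sum>z\<in>?V. if z = vec_add n t x then 2 ^ n * (w x * cnj (w z)) else 0)"
      by (intro sum.cong refl) (auto simp: sum_vec_char vec_add_closed Z2.add_eq_zero_iff)
    also have "\<dots> = 2 ^ n * (w x * cnj (w (vec_add n t x)))"
      using Z2.finite_carrier vec_add_closed by simp
    finally show ?thesis .
  qed
  have "0 = (\<Sum>y\<in>?V. of_int (vec_char n y t) * complex_of_real c)"
    using sum_vec_char[OF t(1)] t(2) by (simp flip: sum_distrib_right of_int_sum)
  also have "\<dots> = (\<Sum>y\<in>?V. of_int (vec_char n y t) * (F y * cnj (F y)))"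
    using sq by (intro sum.cong) auto
  \<comment> \<open>The characters are real, so conjugation fixes them and the three factors at
    \<open>t\<close>, \<open>x\<close> and \<open>z\<close> merge into one.\<close>
  also have "\<dots> = (\<Sum>y\<in>?V. \<Sum>x\<in>?V. \<Sum>z\<in>?V.
      w x * cnj (w z) * of_int (vec_char n y (vec_add n (vec_add n t x) z)))"
    unfolding F_def cnj_sum sum_product unfolding sum_distrib_left
    by (intro sum.cong refl) (simp add: vec_char_add)
  also have "\<dots> = (\<Sum>x\<in>?V. \<Sum>y\<in>?V. \<Sum>z\<in>?V.
      w x * cnj (w z) * of_int (vec_char n y (vec_add n (vec_add n t x) z)))"
    by (rule sum.swap)
  also have "\<dots> = (\<Sum>x\<in>?V. \<Sum>z\<in>?V. \<Sum>y\<in>?V.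
      w x * cnj (w z) * of_int (vec_char n y (vec_add n (vec_add n t x) z)))"
    by (intro sum.cong refl sum.swap)
  also have "\<dots> = (\<Sum>x\<in>?V. 2 ^ n * (w x * cnj (w (vec_add n t x))))"
    using inner by (simp add: sum_distrib_left)
  also have "\<dots> = 2 ^ n * (\<Sum>x\<in>?V. w x * cnj (w (vec_add n t x)))"
    by (simp add: sum_distrib_left)
  finally show ?thesis by simp
qed

section \<open>Powers of \<open>zeta\<close> and doubling of the modulus\<close>

lemma zeta_power_self: "m > 0 \<Longrightarrow> zeta m ^ m = 1"
  unfolding zeta_def by (simp flip: exp_of_nat_mult)

lemma zeta_double_square: "zeta (2 * m) ^ 2 = zeta m"
  unfolding zeta_def by (simp add: power2_eq_square flip: exp_add) (simp add: field_simps)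

lemma zeta_double_half_period: "m > 0 \<Longrightarrow> zeta (2 * m) ^ m = -1"
  unfolding zeta_def by (simp flip: exp_of_nat_mult)

lemma zeta_neq_zero: "zeta m \<noteq> 0"
  by (simp add: zeta_def)

lemma norm_zeta: "norm (zeta m) = 1"
proof -
  have "zeta m = exp (\<i> * of_real (2 * pi / of_nat m))"
    unfolding zeta_def by (simp add: mult_ac)
  then show ?thesis by (simp flip: cis_conv_exp)
qed

text \<open>Conjugation inverts roots of unity; the exponent \<open>m - 1\<close> in place of -1
  keeps all exponents natural.\<close>

lemma cnj_zeta_power:
  assumes "m > 0"
  shows "cnj (zeta m ^ k) = zeta m ^ ((m - 1) * k)"
proof -
  have "zeta m * cnj (zeta m) = 1"
    using complex_norm_square[of "zeta m"] by (simp add: norm_zeta)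
  moreover have "zeta m * zeta m ^ (m - 1) = 1"
    using zeta_power_self[OF assms] assms by (metis power_minus_mult mult.commute)
  ultimately have "cnj (zeta m) = zeta m ^ (m - 1)"
    using zeta_neq_zero mult_left_cancel by metis
  then show ?thesis by (simp add: power_mult)
qed

text \<open>As \<open>zeta m\<close> is the square of \<open>zeta (2 * m)\<close>, the transform is
  unchanged. This reduces modulus \<open>p ^ \<alpha>\<close> to modulus
  \<open>2 * p ^ \<alpha>\<close>.\<close>

lemma is_gbf_double:
  assumes "is_gbf m n f"
  shows "is_gbf (2 * m) n (\<lambda>x. 2 * f x)"
proof -
  have "zeta (2 * m) powi (2 * k) = zeta m powi k" for k
    using zeta_double_square[of m] by (simp add: power_int_mult)
  then have "gbf_transform (2 * m) n (\<lambda>x. 2 * f x) y = gbf_transform m n f y" for y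
    unfolding gbf_transform_def by simp
  moreover have "(\<lambda>x. 2 * f x) \<in> Z2_vec n \<rightarrow> carrier (residue_ring (int (2 * m)))"
    using assms unfolding is_gbf_def residue_ring_def by fastforce
  ultimately show ?thesis using assms unfolding is_gbf_def by simp
qed

section \<open>From generalized bent functions to sign functions\<close>

theorem is_gbf_bound:
  assumes p: "prime p" "odd p" and n: "odd n" and f: "is_gbf (2 * p ^ \<alpha>) n f"
  shows "n \<ge> 3 \<and> (p < 2 ^ (n - 3) \<or> int p = 2 ^ (n - 2) - 1)"
proof -
  let ?V = "Z2_vec n"
  define q where "q = p ^ \<alpha>"
  define \<zeta> where "\<zeta> = zeta (2 * q)"
  define e where "e x = nat (f x)" for x
  define g :: "(nat \<Rightarrow> int) \<Rightarrow> int" where "g x = (-1) ^ e x" for x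
  have q: "q > 0" unfolding q_def using p prime_gt_0_nat by simp
  have powi: "\<zeta> powi f x = \<zeta> ^ e x" if "x \<in> ?V" for x
  proof -
    have "f x \<ge> 0" using f that unfolding is_gbf_def residue_ring_def by fastforce
    then show ?thesis by (simp add: e_def power_int_def)
  qed
  have flat: "(cmod (\<Sum>x\<in>?V. \<zeta> ^ e x * of_int (vec_char n y x)))\<^sup>2 = 2 ^ n" if "y \<in> ?V" for y
  proof -
    have "(\<Sum>x\<in>?V. \<zeta> ^ e x * of_int (vec_char n y x)) = gbf_transform (2 * q) n f y"
      unfolding gbf_transform_def
      by (intro sum.cong) (simp_all add: powi vec_char_Z2_inner flip: \<zeta>_def)
    then show ?thesis using f that unfolding is_gbf_def q_def by simp
  qed
  have "int p dvd Z2.autocorr n g t" if t: "t \<in> ?V" "t \<noteq> vec_zero n" for t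
  proof -
    \<comment> \<open>The factor \<open>2 * q - 1\<close> encodes conjugation. Being odd, it
      disappears when \<open>\<zeta>\<close> is replaced by -1, which leaves the autocorrelation of
      \<open>g\<close>.\<close>
    define b where "b x = e x + (2 * q - 1) * e (vec_add n t x)" for x
    have "(\<Sum>x\<in>?V. \<zeta> ^ b x) = (\<Sum>x\<in>?V. \<zeta> ^ e x * cnj (\<zeta> ^ e (vec_add n t x)))"
      unfolding b_def \<zeta>_def using q by (simp add: cnj_zeta_power power_add del: complex_cnj_power)
    also have "\<dots> = 0" by (rule flat_spectrum_autocorr_zero[OF flat t])
    finally have "int p dvd (\<Sum>x\<in>?V. (-1) ^ b x)"
      using q by (intro vanishing_sum_mod_prime[OF p(1) _ Z2.finite_carrier, of \<zeta> \<alpha>])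
        (auto simp: \<zeta>_def zeta_double_half_period simp flip: q_def)
    moreover have "(-1) ^ b x = g x * g (vec_add n t x)" for x
    proof -
      have "odd (2 * q - 1)" using q by simp
      then show ?thesis unfolding b_def g_def by (simp add: power_add power_mult)
    qed
    ultimately show ?thesis unfolding Z2.autocorr_def by simp
  qed
  moreover have "g x = 1 \<or> g x = -1" for x
    unfolding g_def by (cases "even (e x)") auto
  \<comment> \<open>An odd \<open>n\<close> is positive, so coordinate 0 exists and provides a
    nontrivial character.\<close>
  moreover have "vec_char n (unit_vec n 0) (unit_vec n 0) = -1"
    using vec_char_unit_vec[OF odd_pos[OF n], of "unit_vec n 0"] odd_pos[OF n] by (simp add: unit_vec_def)
  ultimately show ?thesis
    using Z2.prime_dvd_autocorr_bound[OF _ card_Z2_vec n p _ sign_character_vec_char unit_vec_mem]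
    by blast
qed

theorem theorem3p8:
  fixes n :: nat
  assumes "n \<ge> 1" and "odd n"
  shows "(\<forall>p \<alpha> :: nat. prime p \<longrightarrow> odd p \<longrightarrow> \<alpha> \<ge> 1 \<longrightarrow>
            (\<exists>f. is_gbf (2 * p ^ \<alpha>) n f) \<longrightarrow>
            real p < 2 powi (int n - 3) \<or>
            (real p = 2 powi (int n - 2) - 1 \<and> mersenne_prime p)) \<and>
         (n \<le> 3 \<longrightarrow>
           (\<forall>p \<alpha> :: nat. prime p \<longrightarrow> odd p \<longrightarrow> \<alpha> \<ge> 1 \<longrightarrow>
              \<not> (\<exists>f. is_gbf (p ^ \<alpha>) n f) \<and> \<not> (\<exists>f. is_gbf (2 * p ^ \<alpha>) n f)))"
proof (intro conjI allI impI)
  fix p \<alpha> :: nat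
  assume p: "prime p" "odd p" and ex: "\<exists>f. is_gbf (2 * p ^ \<alpha>) n f"
  from ex have n: "n \<ge> 3" and b: "p < 2 ^ (n - 3) \<or> int p = 2 ^ (n - 2) - 1"
    using is_gbf_bound[OF p assms(2)] by auto
  \<comment> \<open>The integer exponents of the statement agree with natural ones because
    \<open>n \<ge> 3\<close>.\<close>
  have powi: "(2::real) powi (int n - 3) = 2 ^ (n - 3)" "(2::real) powi (int n - 2) = 2 ^ (n - 2)"
    using n by (simp_all add: power_int_def nat_diff_distrib)
  from b show "real p < 2 powi (int n - 3) \<or> (real p = 2 powi (int n - 2) - 1 \<and> mersenne_prime p)"
  proof
    assume "p < 2 ^ (n - 3)"
    then have "real p < real (2 ^ (n - 3))" by (simp only: of_nat_less_iff)
    then show ?thesis unfolding powi by simp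
  next
    assume "int p = 2 ^ (n - 2) - 1"
    then have p1: "p + 1 = 2 ^ (n - 2)" by (metis add.commute diff_add_cancel of_nat_1 of_nat_add of_nat_eq_iff of_nat_numeral of_nat_power)
    then have "real p + 1 = 2 ^ (n - 2)" by (metis of_nat_1 of_nat_add of_nat_numeral of_nat_power)
    moreover have "p = 2 ^ (n - 2) - 1" using p1 by simp
    ultimately show ?thesis using p(1) unfolding powi mersenne_prime_def by auto
  qed
next
  fix p \<alpha> :: nat
  assume "n \<le> 3" and p: "prime p" "odd p"
  \<comment> \<open>Only \<open>n = 3\<close> is left, where the two alternatives read
    \<open>p < 1\<close> and \<open>p = 1\<close>.\<close>
  have "p \<ge> 2" using p(1) by (rule prime_ge_2_nat)
  then have no: "\<not> is_gbf (2 * p ^ \<alpha>) n f" for f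
    using is_gbf_bound[OF p assms(2), of \<alpha> f] \<open>n \<le> 3\<close> by auto
  then show "\<not> (\<exists>f. is_gbf (2 * p ^ \<alpha>) n f)" by blast
  show "\<not> (\<exists>f. is_gbf (p ^ \<alpha>) n f)" using no is_gbf_double by blast
qed

end
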